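(* There exists a constant $c_1 > 0$ such that $$s(n) \geq \frac{n^2}{2^{(c_1+o(1))\sqrt{\log_2 n}}},$$ where $o(1)$ denotes a quantity tending to $0$ as $n \to \infty$.
   Context: A skew corner is a configuration of points of the form $(x,y),(x,y+d),(x+d,y')$ with $x,y,y',d \in \mathbb{Z}$; it is non-trivial if $d \neq 0$. A subset of $\mathbb{Z}^2$ is skew corner-free if it contains no non-trivial skew corner. For a positive integer $n$, $[n]=\{1,\dots,n\}$ and $s(n)$ denotes the largest size of a skew corner-free subset of $[n]^2$. *)

theory Defs
  imports Complex_Main
begin

definition skew_corner :: "int \<Rightarrow> int \<Rightarrow> int \<Rightarrow> int \<Rightarrow> (int \<times> int) set" where
  "skew_corner x y y' d = {(x, y), (x, y + d), (x + d, y')}"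

definition skew_corner_free :: "(int \<times> int) set \<Rightarrow> bool" where
  "skew_corner_free A \<longleftrightarrow> \<not> (\<exists>x y y' d. d \<noteq> 0 \<and> skew_corner x y y' d \<subseteq> A)"

definition max_skew_corner_free :: "nat \<Rightarrow> nat" where
  "max_skew_corner_free n =
     Max {card A | A. A \<subseteq> {1..int n} \<times> {1..int n} \<and> skew_corner_free A}"

end

theory Submission
  imports Defs "HOL-Library.FuncSet"
begin

text \<open>
  The construction is a variant of Behrend's. Work in the box of vectors with \<open>k\<close> digits below
  \<open>m\<close>, and let the set of nonempty columns be the points \<open>x\<close> of a popular sphere. Over \<open>x\<close> take
  the points \<open>y\<close> of a popular hyperplane orthogonal to \<open>x\<close>. If \<open>y\<close> and \<open>y + d\<close> both lie over
  \<open>x\<close>, then \<open>d\<close> is orthogonal to \<open>x\<close>, so \<open>x + d\<close> is longer than \<open>x\<close> and lies off the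
  sphere unless \<open>d = 0\<close>. Reading vectors as digit expansions in base \<open>2m\<close>, where sums of
  two vectors do not carry, transfers this to the integers. The two pigeonhole steps each lose a
  factor of about \<open>k * m\<^sup>2\<close>, and each coordinate loses \<open>2 ^ k\<close> to the base; these balance for
  \<open>k \<approx> sqrt (log 2 n)\<close> and \<open>m \<approx> 2 ^ k\<close>.
\<close>

section \<open>Popular values by averaging over fibers\<close>

lemma pigeonhole_fiber:
  assumes "finite A" "finite B" "B \<noteq> {}" "f ` A \<subseteq> B"
  shows "\<exists>v. card A \<le> card B * card {a \<in> A. f a = v}"
proof (rule ccontr)
  assume "\<not> ?thesis"
  then have less: "card B * card {a \<in> A. f a = v} < card A" for v
    by (simp add: not_le)
  have "A = (\<Union>v\<in>B. {a \<in> A. f a = v})"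
    using assms(4) by auto
  then have "card A \<le> (\<Sum>v\<in>B. card {a \<in> A. f a = v})"
    using card_UN_le[OF assms(2), of "\<lambda>v. {a \<in> A. f a = v}"] by simp
  then have "card B * card A \<le> (\<Sum>v\<in>B. card B * card {a \<in> A. f a = v})"
    by (simp add: sum_distrib_left[symmetric])
  also have "\<dots> < (\<Sum>v\<in>B. card A)"
    using assms(2,3) less by (intro sum_strict_mono) auto
  finally show False by simp
qed

section \<open>Digit expansions in a fixed base\<close>

definition digit_value :: "nat \<Rightarrow> nat \<Rightarrow> (nat \<Rightarrow> nat) \<Rightarrow> nat" where
  "digit_value b k x = (\<Sum>i<k. x i * b ^ i)"

lemma digit_value_Suc:
  "digit_value b (Suc k) x = x 0 + b * digit_value b k (\<lambda>i. x (Suc i))"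
  unfolding digit_value_def
  by (subst sum.lessThan_Suc_shift) (simp add: sum_distrib_left mult_ac)

text \<open>Evaluation is linear whatever the size of the digits; size matters only for uniqueness,
  in \<open>digit_value_inj\<close>.\<close>

lemma digit_value_add:
  "digit_value b k (\<lambda>i. x i + y i) = digit_value b k x + digit_value b k y"
  by (simp add: digit_value_def sum.distrib algebra_simps)

lemma digit_value_less:
  assumes "\<And>i. i < k \<Longrightarrow> x i < b"
  shows "digit_value b k x < b ^ k"
  using assms
proof (induction k arbitrary: x)
  case 0
  then show ?case by (simp add: digit_value_def)
next
  case (Suc k)
  have "digit_value b k (\<lambda>i. x (Suc i)) < b ^ k"
    by (rule Suc.IH) (simp add: Suc.prems)
  then have "b * (digit_value b k (\<lambda>i. x (Suc i)) + 1) \<le> b * b ^ k"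
    by (intro mult_le_mono) auto
  moreover have "x 0 < b" by (rule Suc.prems) simp
  ultimately show ?case by (simp add: digit_value_Suc)
qed

text \<open>Reducing modulo \<open>b\<close> recovers the lowest digit; cancelling it leaves the
  same claim for the remaining digits.\<close>

lemma digit_value_inj:
  assumes "\<And>i. i < k \<Longrightarrow> x i < b" "\<And>i. i < k \<Longrightarrow> y i < b"
    and "digit_value b k x = digit_value b k y" "i < k"
  shows "x i = y i"
  using assms
proof (induction k arbitrary: x y i)
  case (Suc k)
  have x0: "x 0 < b" and y0: "y 0 < b"
    using Suc.prems by auto
  have eq: "x 0 + b * digit_value b k (\<lambda>i. x (Suc i)) = y 0 + b * digit_value b k (\<lambda>i. y (Suc i))"
    using Suc.prems(3) by (simp add: digit_value_Suc)
  from arg_cong[OF eq, of "\<lambda>t. t mod b"] have 0: "x 0 = y 0"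
    using x0 y0 by simp
  with eq x0 have "digit_value b k (\<lambda>i. x (Suc i)) = digit_value b k (\<lambda>i. y (Suc i))"
    by simp
  then have "x (Suc j) = y (Suc j)" if "j < k" for j
    using Suc.IH[of "\<lambda>i. x (Suc i)" "\<lambda>i. y (Suc i)" j] Suc.prems that by auto
  with 0 Suc.prems(4) show ?case
    by (cases i) auto
qed simp

text \<open>Extensionality makes a vector determined by its first \<open>k\<close> digits, so the
  box has exactly \<open>m ^ k\<close> elements.\<close>

abbreviation digit_box :: "nat \<Rightarrow> nat \<Rightarrow> (nat \<Rightarrow> nat) set" where
  "digit_box m k \<equiv> {..<k} \<rightarrow>\<^sub>E {..<m}"

lemma inj_on_digit_value:
  assumes "m \<le> b"
  shows "inj_on (digit_value b k) (digit_box m k)"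
proof (rule inj_onI)
  fix x y assume x: "x \<in> digit_box m k" and y: "y \<in> digit_box m k"
    and eq: "digit_value b k x = digit_value b k y"
  have "x i = y i" if "i < k" for i
  proof (rule digit_value_inj[OF _ _ eq that])
    show "x i < b" "y i < b" if "i < k" for i
      using x y that assms by (auto simp: PiE_iff intro: less_le_trans)
  qed
  then show "x = y"
    using x y by (intro PiE_ext[OF x y]) auto
qed

section \<open>Scalar products and spheres\<close>

lemma scalar_product_digit_box_le:
  assumes "x \<in> digit_box m k" "y \<in> digit_box m k"
  shows "(\<Sum>i<k. x i * y i) \<le> k * m\<^sup>2"
proof -
  have "(\<Sum>i<k. x i * y i) \<le> (\<Sum>i<k. m * m)"
    using assms by (intro sum_mono mult_le_mono) (auto simp: PiE_iff intro: less_imp_le)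
  then show ?thesis by (simp add: power2_eq_square)
qed

text \<open>With d = \<open>y' - y\<close> and \<open>x'\<close> = \<open>x\<close> + d, the squared
  norm of \<open>x'\<close> is that of \<open>x\<close> plus twice the scalar product of
  \<open>x\<close> and d plus that of d. The middle term vanishes by \<open>plane\<close>, so
  \<open>sphere\<close> forces d = 0. The hypothesis \<open>shift\<close> uses sums because
  subtraction on naturals truncates.\<close>

lemma sphere_tangent_eq:
  fixes x x' y y' :: "'i \<Rightarrow> nat"
  assumes "finite I"
    and shift: "\<And>i. i \<in> I \<Longrightarrow> x i + y' i = x' i + y i"
    and sphere: "(\<Sum>i\<in>I. x i * x i) = (\<Sum>i\<in>I. x' i * x' i)"
    and plane: "(\<Sum>i\<in>I. x i * y i) = (\<Sum>i\<in>I. x i * y' i)"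
    and "i \<in> I"
  shows "y i = y' i"
proof -
  have sphere': "(\<Sum>i\<in>I. int (x i) * int (x i)) = (\<Sum>i\<in>I. int (x' i) * int (x' i))"
    using arg_cong[OF sphere, of int] by simp
  have plane': "(\<Sum>i\<in>I. int (x i) * int (y i)) = (\<Sum>i\<in>I. int (x i) * int (y' i))"
    using arg_cong[OF plane, of int] by simp
  have "(int (y' i) - int (y i))\<^sup>2 = int (x' i) * int (x' i) - int (x i) * int (x i)
      - 2 * (int (x i) * int (y' i) - int (x i) * int (y i))" if "i \<in> I" for i
  proof -
    have x': "int (x' i) = int (x i) + int (y' i) - int (y i)"
      using shift[OF that] by linarith
    show ?thesis
      unfolding x' by (simp add: power2_eq_square algebra_simps)
  qed
  then have "(\<Sum>i\<in>I. (int (y' i) - int (y i))\<^sup>2) = (\<Sum>i\<in>I. int (x' i) * int (x' i) - int (x i) * int (x i)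
      - 2 * (int (x i) * int (y' i) - int (x i) * int (y i)))"
    by (intro sum.cong) auto
  also have "\<dots> = 0"
    by (simp add: sum_subtractf sum_distrib_left[symmetric] sphere' plane')
  finally have "(int (y' i) - int (y i))\<^sup>2 = 0"
    using assms(1,5) by (subst (asm) sum_nonneg_eq_0_iff) auto
  then show ?thesis by simp
qed

section \<open>The construction and its size\<close>

lemma card_le_max_skew_corner_free:
  assumes "A \<subseteq> {1..int n} \<times> {1..int n}" "skew_corner_free A"
  shows "card A \<le> max_skew_corner_free n"
proof -
  have "finite {card A | A. A \<subseteq> {1..int n} \<times> {1..int n} \<and> skew_corner_free A}"
    by (rule finite_subset[of _ "card ` Pow ({1..int n} \<times> {1..int n})"]) auto
  then show ?thesis
    unfolding max_skew_corner_free_def using assms by (intro Max_ge) auto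
qed

text \<open>The number of values available to a scalar product on the box is
  \<open>k * m\<^sup>2 + 1\<close>. One such factor pays for the sphere, the other for the
  hyperplanes.\<close>

lemma max_skew_corner_free_lower:
  assumes n: "(2 * m) ^ k \<le> n"
  shows "(m ^ k)\<^sup>2 \<le> (k * m\<^sup>2 + 1)\<^sup>2 * max_skew_corner_free n"
proof -
  define D where "D = digit_box m k"
  have finD: "finite D" and cardD: "card D = m ^ k"
    by (auto simp: D_def finite_PiE card_PiE)
  have small: "x i < m" if "x \<in> D" "i < k" for x i
    using that by (auto simp: D_def PiE_iff)
  \<comment> \<open>Digit values start at 0 but the grid starts at 1.\<close>
  define v where "v x = int (digit_value (2 * m) k x) + 1" for x
  have v_inj: "inj_on v D"
    using inj_on_digit_value[of m "2 * m" k] by (auto simp: D_def v_def inj_on_def)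
  have v_range: "v x \<in> {1..int n}" if "x \<in> D" for x
  proof -
    have "digit_value (2 * m) k x < (2 * m) ^ k"
      using small[OF that] by (intro digit_value_less) fastforce
    then show ?thesis using n by (auto simp: v_def)
  qed
  have prod_le: "(\<Sum>i<k. x i * y i) \<in> {..k * m\<^sup>2}" if "x \<in> D" "y \<in> D" for x y
    using scalar_product_digit_box_le that by (auto simp: D_def)
  obtain r where r: "m ^ k \<le> (k * m\<^sup>2 + 1) * card {x \<in> D. (\<Sum>i<k. x i * x i) = r}"
    using pigeonhole_fiber[of D "{..k * m\<^sup>2}" "\<lambda>x. \<Sum>i<k. x i * x i"] finD prod_le
    by (auto simp: cardD image_subset_iff)
  define X where "X = {x \<in> D. (\<Sum>i<k. x i * x i) = r}"
  have "\<exists>c. m ^ k \<le> (k * m\<^sup>2 + 1) * card {y \<in> D. (\<Sum>i<k. x i * y i) = c}" if "x \<in> D" for x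
    using pigeonhole_fiber[of D "{..k * m\<^sup>2}" "\<lambda>y. \<Sum>i<k. x i * y i"] finD prod_le that
    by (auto simp: cardD image_subset_iff)
  \<comment> \<open>The level \<open>c x\<close> may depend on the column, since orthogonality only
    compares two points over the same \<open>x\<close>.\<close>
  then have "\<exists>c. \<forall>x\<in>D. m ^ k \<le> (k * m\<^sup>2 + 1) * card {y \<in> D. (\<Sum>i<k. x i * y i) = c x}"
    by (intro bchoice ballI)
  then obtain c where
    c: "\<forall>x\<in>D. m ^ k \<le> (k * m\<^sup>2 + 1) * card {y \<in> D. (\<Sum>i<k. x i * y i) = c x}"
    by blast
  define Y where "Y x = {y \<in> D. (\<Sum>i<k. x i * y i) = c x}" for x
  define A where "A = map_prod v v ` (SIGMA x:X. Y x)"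
  have XD: "X \<subseteq> D" and YD: "Y x \<subseteq> D" for x
    by (auto simp: X_def Y_def)
  have finX: "finite X" and finY: "finite (Y x)" for x
    using finD XD YD finite_subset by blast+
  have "skew_corner_free A"
    unfolding skew_corner_free_def
  proof clarify
    fix p q q' d assume d: "d \<noteq> 0" and sub: "skew_corner p q q' d \<subseteq> A"
    then have "(p, q) \<in> A" "(p, q + d) \<in> A" "(p + d, q') \<in> A"
      by (auto simp: skew_corner_def)
    then obtain x y x1 y' x' where x: "x \<in> X" "y \<in> Y x" "p = v x" "q = v y"
      and x1: "x1 \<in> X" "y' \<in> Y x1" "p = v x1" "q + d = v y'"
      and x': "x' \<in> X" "p + d = v x'"
      unfolding A_def by auto
    have "x1 = x"
      using v_inj x(1,3) x1(1,3) XD by (auto simp: inj_on_def)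
    with x1 have y': "y' \<in> Y x" by simp
    \<comment> \<open>Eliminating \<open>d\<close> leaves only sums, in which the shifts by one
      cancel.\<close>
    have "v x + v y' = v x' + v y"
      using x x1 x' by simp
    then have eq: "digit_value (2 * m) k (\<lambda>i. x i + y' i) = digit_value (2 * m) k (\<lambda>i. x' i + y i)"
      by (simp add: v_def digit_value_add)
    have mem: "x \<in> D" "x' \<in> D" "y \<in> D" "y' \<in> D"
      using x x' y' XD YD by auto
    have shift: "x i + y' i = x' i + y i" if "i < k" for i
    proof (rule digit_value_inj[OF _ _ eq that])
      show "x i + y' i < 2 * m" "x' i + y i < 2 * m" if "i < k" for i
        using small[OF mem(1) that] small[OF mem(2) that] small[OF mem(3) that] small[OF mem(4) that]
        by auto
    qed
    have "y i = y' i" if "i < k" for i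
      by (rule sphere_tangent_eq[of "{..<k}" x y' x' y])
        (use shift that x x' y' in \<open>auto simp: X_def Y_def\<close>)
    then have "y = y'"
      using mem(3,4) unfolding D_def by (intro PiE_ext) auto
    with x x1 d show False by simp
  qed
  moreover have "A \<subseteq> {1..int n} \<times> {1..int n}"
  proof -
    have "(SIGMA x:X. Y x) \<subseteq> D \<times> D"
      using XD YD by blast
    then have "A \<subseteq> map_prod v v ` (D \<times> D)"
      unfolding A_def by (rule image_mono)
    also have "\<dots> = v ` D \<times> v ` D"
      by (rule map_prod_surj_on) simp_all
    also have "\<dots> \<subseteq> {1..int n} \<times> {1..int n}"
      using v_range by (intro Sigma_mono image_subsetI)
    finally show ?thesis .
  qed
  ultimately have le: "card A \<le> max_skew_corner_free n"
    by (intro card_le_max_skew_corner_free)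
  have "inj_on (map_prod v v) (SIGMA x:X. Y x)"
    by (rule inj_on_subset[OF map_prod_inj_on[OF v_inj v_inj]]) (use XD YD in blast)
  then have cardA: "card A = (\<Sum>x\<in>X. card (Y x))"
    using finX finY by (simp add: A_def card_image)
  define K where "K = k * m\<^sup>2 + 1"
  have "(m ^ k)\<^sup>2 \<le> K * card X * m ^ k"
    unfolding power2_eq_square[of "m ^ k"] K_def X_def by (intro mult_le_mono1 r)
  also have "\<dots> = K * (\<Sum>x\<in>X. m ^ k)"
    by simp
  also have "\<dots> \<le> K * (\<Sum>x\<in>X. K * card (Y x))"
    unfolding K_def Y_def using c XD by (intro mult_le_mono2 sum_mono) auto
  also have "\<dots> = K\<^sup>2 * card A"
    by (simp add: cardA sum_distrib_left power2_eq_square mult.assoc)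
  also have "\<dots> \<le> K\<^sup>2 * max_skew_corner_free n"
    using le by (rule mult_le_mono2)
  finally show ?thesis by (simp only: K_def)
qed

lemma max_skew_corner_free_lower_powr:
  assumes "n \<ge> 2"
  shows "(real n)\<^sup>2 / 2 powr (14 * sqrt (log 2 (real n))) \<le> real (max_skew_corner_free n)"
proof -
  define s where "s = sqrt (log 2 (real n))"
  define k where "k = nat \<lfloor>s\<rfloor>"
  have L: "log 2 (real n) \<ge> 1"
    using assms by simp
  then have s1: "s \<ge> 1" and s2: "s\<^sup>2 = log 2 (real n)"
    by (auto simp: s_def)
  have k1: "k \<ge> 1" and ks: "real k \<le> s" and sk: "s < real k + 1"
    using s1 by (auto simp: k_def le_nat_iff le_floor_iff)
  \<comment> \<open>This makes the base \<open>2 * m\<close> equal to \<open>2 ^ k\<close>, so the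
    numbers used are at most \<open>2 ^ (k * k)\<close>, which \<open>k \<le> s\<close> keeps below
    \<open>n\<close>.\<close>
  define m :: nat where "m = 2 ^ (k - 1)"
  have m2: "2 * m = 2 ^ k"
    using k1 by (simp add: m_def power_eq_if)
  have n_powr: "real n = 2 powr s\<^sup>2"
    using assms by (simp add: s2)
  have "real ((2 * m) ^ k) = 2 powr (real k)\<^sup>2"
    by (simp add: m2 power_mult[symmetric] powr_realpow[symmetric] power2_eq_square)
  also have "\<dots> \<le> real n"
    unfolding n_powr using ks by (intro powr_mono power_mono) auto
  finally have "(2 * m) ^ k \<le> n" by (simp only: of_nat_le_iff)
  from max_skew_corner_free_lower[OF this]
  have main: "(m ^ k)\<^sup>2 \<le> (k * m\<^sup>2 + 1)\<^sup>2 * max_skew_corner_free n" .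
  \<comment> \<open>A crude bound suffices: any factor \<open>2 ^ k\<close> lost here only enlarges
    the final constant.\<close>
  have "k * m\<^sup>2 + 1 \<le> 2 ^ k * (2 * m)\<^sup>2"
  proof -
    have "m\<^sup>2 \<ge> 1" by (simp add: m_def)
    then have "k * m\<^sup>2 + 1 \<le> (k + 1) * m\<^sup>2" by simp
    also have "\<dots> \<le> 2 ^ k * (2 * m)\<^sup>2"
      using less_exp[of k] by (intro mult_le_mono power_mono) (auto simp: Suc_le_eq)
    finally show ?thesis .
  qed
  also have "\<dots> = 2 ^ (3 * k)"
    by (simp add: m2 power_mult[symmetric] power_add[symmetric])
  finally have "(k * m\<^sup>2 + 1)\<^sup>2 \<le> (2 ^ (3 * k))\<^sup>2"
    by (intro power_mono) auto
  with main have "(m ^ k)\<^sup>2 \<le> (2 ^ (3 * k))\<^sup>2 * max_skew_corner_free n"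
    using mult_le_mono1 order_trans by blast
  \<comment> \<open>The extra factor completes \<open>m ^ k\<close> to \<open>(2 * m) ^ k\<close>,
    giving exponent \<open>2 * k * k\<close> against \<open>2 * k + 6 * k\<close>.\<close>
  then have "(2 ^ k)\<^sup>2 * (m ^ k)\<^sup>2 \<le> (2 ^ k)\<^sup>2 * ((2 ^ (3 * k))\<^sup>2 * max_skew_corner_free n)"
    by (rule mult_le_mono2)
  moreover have "(2 ^ k)\<^sup>2 * (m ^ k)\<^sup>2 = (2::nat) ^ (2 * k * k)"
    by (simp add: m2 power_mult_distrib[symmetric]) (simp add: power_mult[symmetric] mult_ac)
  moreover have "(2 ^ k)\<^sup>2 * ((2 ^ (3 * k))\<^sup>2 * t) = 2 ^ (8 * k) * t" for t :: nat
    by (simp add: power_mult[symmetric] power_add[symmetric] mult.assoc[symmetric])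
  ultimately have "2 ^ (2 * k * k) \<le> 2 ^ (8 * k) * max_skew_corner_free n"
    by simp
  then have "real (2 ^ (2 * k * k)) \<le> real (2 ^ (8 * k) * max_skew_corner_free n)"
    by (simp only: of_nat_le_iff)
  then have bound: "2 powr (2 * real k * real k) \<le> 2 powr (8 * real k) * real (max_skew_corner_free n)"
    by (simp add: powr_realpow[symmetric])
  have "(real n)\<^sup>2 / 2 powr (14 * s) = 2 powr (2 * s\<^sup>2 - 14 * s)"
    unfolding n_powr by (simp add: powr_diff powr_power)
  \<comment> \<open>Here 14 = 8 + 4 + 2: the loss \<open>8 * k\<close> above, and
    \<open>4 * k + 2\<close> from rounding \<open>s\<close> down to \<open>k\<close>, using
    \<open>k \<le> s\<close> and \<open>1 \<le> s\<close>.\<close>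
  also have "\<dots> \<le> 2 powr (2 * real k * real k - 8 * real k)"
  proof (rule powr_mono)
    have "s\<^sup>2 \<le> (real k + 1)\<^sup>2"
      using s1 sk by (intro power_mono) auto
    then have "2 * s\<^sup>2 \<le> 2 * real k * real k + 4 * real k + 2"
      by (simp add: power2_eq_square algebra_simps)
    then show "2 * s\<^sup>2 - 14 * s \<le> 2 * real k * real k - 8 * real k"
      using ks s1 by linarith
  qed simp
  also have "\<dots> \<le> real (max_skew_corner_free n)"
    using bound by (simp add: powr_diff field_simps)
  finally show ?thesis by (simp add: s_def)
qed

theorem theorem1:
  "\<exists>c\<^sub>1::real. c\<^sub>1 > 0 \<and>
     (\<exists>\<epsilon>::nat \<Rightarrow> real. \<epsilon> \<longlonglongrightarrow> 0 \<and>
       (\<forall>n\<ge>1. real (max_skew_corner_free n) \<ge>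
          (real n)\<^sup>2 / 2 powr ((c\<^sub>1 + \<epsilon> n) * sqrt (log 2 (real n)))))"
\<comment> \<open>The bound is explicit for every \<open>n\<close>, so the error term can be
  zero.\<close>
proof (intro exI[of _ 14] exI[of _ "\<lambda>_. 0"] conjI allI impI)
  fix n :: nat assume "n \<ge> 1"
  then consider "n = 1" | "n \<ge> 2" by linarith
  then show "(real n)\<^sup>2 / 2 powr ((14 + 0) * sqrt (log 2 (real n))) \<le> real (max_skew_corner_free n)"
  proof cases
    case 1
    \<comment> \<open>The logarithm is 0, so a single point is required; the box with
      \<open>k = 0\<close> supplies it.\<close>
    then show ?thesis
      using max_skew_corner_free_lower[of 1 0 1] by simp
  next
    case 2
    then show ?thesis
      using max_skew_corner_free_lower_powr by simp
  qed
qed auto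

end
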